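(* Let $\mathcal{B}$ be the braiding matrix on $V_{2n-1}$ for the fundamental representation of $C_n$, with unknown coefficients $\beta_{a,2n-1-a}^{2n-1-b,b}$. Then for any $a=0,1,\dots,2n-2$ and $a<b\le 2n-1$, $$\beta_{a,2n-1-a}^{2n-1-b,b}=\begin{cases}(q^{1/4}-q^{-1/4})\,q^{-\frac14(a-b)},&(a-n+\frac12)(b-n+\frac12)>0,\\[2pt](q^{-1/4}-q^{1/4})\,q^{-\frac14(a-b-1)}+\delta_a^{2n-1-b}(q^{-1/4}-q^{1/4}),&(a-n+\frac12)(b-n+\frac12)<0.\end{cases}$$
   Context: Let $n\ge1$. Scalars are in $\mathbb{C}(t)$, $t$ an indeterminate, $q=t^4$, $q^{k/4}=t^k$, $i=\sqrt{-1}$. $V_{2n-1}$ is the vector space with basis $\mathcal{J}_{a,2n-1-a}$, $0\le a\le 2n-1$. The braiding matrix is an invertible linear map $\mathcal{B}:V_{2n-1}\to V_{2n-1}$ with entries $\mathcal{B}\mathcal{J}_{a,2n-1-a}=\sum_b\mathcal{B}_{a,2n-1-a}^{b,2n-1-b}\mathcal{J}_{b,2n-1-b}$, of the form $$\mathcal{B}\mathcal{J}_{a,2n-1-a}=q^{1/4}\mathcal{J}_{2n-1-a,a}+\sum_{b=a+1}^{2n-1}\beta_{a,2n-1-a}^{2n-1-b,b}\mathcal{J}_{2n-1-b,b},$$ and satisfying on $V_{2n-1}$ the relation $$\mathcal{B}_{a,2n-1-a}^{b,2n-1-b}-(\mathcal{B}^{-1})_{a,2n-1-a}^{b,2n-1-b}=(q^{1/4}-q^{-1/4})\left(\mathcal{M}_{a,2n-1-a}\mathcal{M}^{b,2n-1-b}-\delta_a^b\right)\quad(0\le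 a,b\le 2n-1),$$ where the fusion matrix is $\mathcal{M}_{a,2n-1-a}=\mathcal{M}^{a,2n-1-a}=-i\,q^{\frac{n-a}{4}}$ for $0\le a\le n-1$ and $=i\,q^{\frac{n-1-a}{4}}$ for $n\le a\le 2n-1$. *)

theory Defs
  imports "HOL-Computational_Algebra.Computational_Algebra"
begin

text \<open>Every index pair \<open>(a, 2n-1-a)\<close> is represented by its first component \<open>a\<close>:
  \<open>J a\<close> stands for the basis vector with index \<open>(a, 2n-1-a)\<close>, and \<open>\<beta> a c\<close> for the
  coefficient with lower index \<open>(a, 2n-1-a)\<close> and upper index \<open>(c, 2n-1-c)\<close>.\<close>

type_synonym scalar = "complex poly fract"

definition tvar :: scalar where
  "tvar = Fraction_Field.Fract [:0, 1:] 1"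

text \<open>With \<open>q = t ^ 4\<close>, this is \<open>q\<close> to the power \<open>k/4\<close>.\<close>
definition qquarter :: "int \<Rightarrow> scalar" where
  "qquarter k = tvar powi k"

definition imag :: scalar where
  "imag = Fraction_Field.Fract [:\<i>:] 1"

text \<open>The lower-index and the upper-index fusion coefficients coincide, so one function serves
  for both.\<close>
definition fusion :: "nat \<Rightarrow> nat \<Rightarrow> scalar" where
  "fusion n a = (if a < n then - imag * qquarter (int n - int a)
                 else imag * qquarter (int n - 1 - int a))"

definition kdelta :: "nat \<Rightarrow> nat \<Rightarrow> scalar" where
  "kdelta a b = (if a = b then 1 else 0)"

definition is_basis_family ::
    "(scalar \<Rightarrow> 'v::ab_group_add \<Rightarrow> 'v) \<Rightarrow> nat \<Rightarrow> (nat \<Rightarrow> 'v) \<Rightarrow> bool" where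
  "is_basis_family scale m J \<longleftrightarrow>
     inj_on J {0..m} \<and> \<not> module.dependent scale (J ` {0..m}) \<and>
     module.span scale (J ` {0..m}) = UNIV"

text \<open>The coefficient of \<open>J b\<close> in \<open>f (J a)\<close>: \<open>a\<close> is the lower (input) index and \<open>b\<close> the
  upper (output) index.\<close>
definition mat_entry ::
    "(scalar \<Rightarrow> 'v::ab_group_add \<Rightarrow> 'v) \<Rightarrow> nat \<Rightarrow> (nat \<Rightarrow> 'v) \<Rightarrow> ('v \<Rightarrow> 'v) \<Rightarrow> nat \<Rightarrow> nat \<Rightarrow> scalar" where
  "mat_entry scale m J f a b = module.representation scale (J ` {0..m}) (f (J a)) (J b)"

end

theory Submission
  imports Defs
begin

text \<open>Put \<open>N = 2n - 1\<close>. Since \<open>B\<close> is anti-triangular with invertible antidiagonal entries, its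
  inverse is anti-triangular in the opposite direction: its entry with indices \<open>a, c\<close> vanishes for
  \<open>a + c < N\<close>. For these indices the relation between \<open>B\<close>, its inverse and the fusion matrix
  determines the entry of \<open>B\<close>. These are exactly the entries \<open>\<beta>\<close>, with \<open>c = N - b\<close> and \<open>a < b\<close>.\<close>

lemma tvar_nonzero: "tvar \<noteq> 0"
  by (simp add: tvar_def Zero_fract_def eq_fract)

lemma qquarter_nonzero: "qquarter k \<noteq> 0"
  by (simp add: qquarter_def tvar_nonzero)

lemma qquarter_add: "qquarter (j + k) = qquarter j * qquarter k"
  by (simp add: qquarter_def tvar_nonzero power_int_add)

lemma imag_mult_imag: "imag * imag = -1"
  by (simp add: imag_def One_fract_def one_pCons)

text \<open>The reflection \<open>b\<close> \<mapsto> \<open>2*n-1-b\<close> swaps the two halves of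
  the index range. So if \<open>a\<close> and \<open>b\<close> lie in the same half, the factors
  come from opposite branches of \<open>fusion\<close> and (-i)i = 1; otherwise both come from the
  same branch and (\<plusminus>i)^2 = -1.\<close>

lemma fusion_mult:
  assumes "a < b" and "b \<le> 2*n-1"
  shows "fusion n a * fusion n (2*n-1-b) =
    (if a < n \<longleftrightarrow> b < n then qquarter (int b - int a) else - qquarter (int b - int a + 1))"
proof -
  have [simp]: "2*n-1-b < n \<longleftrightarrow> \<not> b < n" and c: "int (2*n-1-b) = 2 * int n - 1 - int b"
    using assms by auto
  have prod: "imag * x * (imag * y) = - (x * y)" for x y
  proof -
    have "imag * x * (imag * y) = imag * imag * (x * y)" by (simp only: mult_ac)
    then show ?thesis by (simp add: imag_mult_imag)
  qed
  show ?thesis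
    using assms by (auto simp: fusion_def c prod qquarter_add[symmetric] intro!: arg_cong[of _ _ qquarter])
qed

text \<open>Back substitution: the formula for \<open>B (J (N - c))\<close> has leading term a
  nonzero multiple of \<open>J c\<close>, and its other terms are \<open>J c'\<close> with
  \<open>c' < c\<close>. Solving for \<open>J c\<close> and applying \<open>inv B\<close> reduces
  the claim to smaller indices.\<close>

lemma (in vector_space) inv_anti_triangular_in_span:
  fixes J :: "nat \<Rightarrow> 'b"
  assumes lin: "Vector_Spaces.linear scale scale B" and "bij B"
    and B: "\<And>a. a \<le> N \<Longrightarrow>
      B (J a) = scale (d a) (J (N - a)) + (\<Sum>b = a+1..N. scale (\<beta> a (N - b)) (J (N - b)))"
    and d: "\<And>a. a \<le> N \<Longrightarrow> d a \<noteq> 0"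
    and "c \<le> N"
  shows "inv B (J c) \<in> span (J ` {N - c..N})"
  using \<open>c \<le> N\<close>
proof (induction c rule: less_induct)
  case (less c)
  define a where "a = N - c"
  have a: "a \<le> N" "N - a = c" using less.prems by (auto simp: a_def)
  interpret B: Vector_Spaces.linear scale scale B by (rule lin)
  have "surj B" and "inj B" using \<open>bij B\<close> by (auto simp: bij_def)
  let ?w = "\<Sum>b = a+1..N. scale (\<beta> a (N - b)) (inv B (J (N - b)))"
  have "B (scale (inverse (d a)) (J a - ?w)) =
      scale (inverse (d a)) (B (J a) - (\<Sum>b = a+1..N. scale (\<beta> a (N - b)) (J (N - b))))"
    by (simp add: B.scale B.diff B.sum surj_f_inv_f[OF \<open>surj B\<close>])
  also have "\<dots> = J c" by (simp add: B[OF a(1)] a(2) d[OF a(1)])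
  finally have "inv B (J c) = scale (inverse (d a)) (J a - ?w)"
    by (metis inv_f_f[OF \<open>inj B\<close>])
  moreover have "J a \<in> span (J ` {a..N})" using a by (intro span_base) auto
  moreover have "inv B (J (N - b)) \<in> span (J ` {a..N})" if "b \<in> {a+1..N}" for b
  proof -
    \<comment> \<open>As \<open>b > a\<close>, the index \<open>N - b\<close> is below
      \<open>c\<close>, and the span given by induction starts at \<open>b\<close>, hence inside the
      one starting at \<open>a\<close>.\<close>
    have "inv B (J (N - b)) \<in> span (J ` {N - (N - b)..N})"
      using that a by (intro less.IH) auto
    moreover have "J ` {N - (N - b)..N} \<subseteq> J ` {a..N}" using that by (intro image_mono) auto
    ultimately show ?thesis using span_mono by blast
  qed
  ultimately show ?case unfolding a_def[symmetric]
    by (auto intro!: span_scale span_diff span_sum)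
qed

lemma (in vector_space) representation_anti_triangular:
  fixes J :: "nat \<Rightarrow> 'b"
  assumes "inj_on J {0..N}" and "independent (J ` {0..N})" and "a < b" and "b \<le> N"
  shows "representation (J ` {0..N})
      (scale d (J (N - a)) + (\<Sum>k = a+1..N. scale (\<beta> (N - k)) (J (N - k)))) (J (N - b)) = \<beta> (N - b)"
proof -
  have sp: "J (N - k) \<in> span (J ` {0..N})" for k by (intro span_base) auto
  have rep: "representation (J ` {0..N}) (J (N - k)) (J (N - b)) = (if k = b then 1 else 0)"
    if "k \<le> N" for k
  proof -
    \<comment> \<open>Subtraction on \<open>nat\<close> truncates, so cancelling \<open>N\<close>
      uses both \<open>k \<le> N\<close> and \<open>b \<le> N\<close>.\<close>
    have "J (N - k) = J (N - b) \<longleftrightarrow> k = b"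
      using that assms inj_on_eq_iff[OF assms(1), of "N - k" "N - b"] by auto
    then show ?thesis using assms(2) by (subst representation_basis) auto
  qed
  have "representation (J ` {0..N}) (\<Sum>k = a+1..N. scale (\<beta> (N - k)) (J (N - k))) (J (N - b)) =
      (\<Sum>k = a+1..N. \<beta> (N - k) * (if k = b then 1 else 0))"
    using assms(2) by (simp add: representation_sum representation_scale sp span_scale rep)
  also have "\<dots> = \<beta> (N - b)" using assms by (simp add: if_distrib sum.delta cong: if_cong)
  finally show ?thesis
    using assms by (simp add: representation_add representation_scale sp span_scale span_sum rep)
qed

text \<open>The shift by 1/2 keeps each factor away from 0, so its sign tells exactly in which half
  the index lies.\<close>

lemma real_half_mult_sign:
  "(real a - real n + 1/2) * (real b - real n + 1/2) > 0 \<longleftrightarrow> (a < n \<longleftrightarrow> b < n)"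
  "(real a - real n + 1/2) * (real b - real n + 1/2) < 0 \<longleftrightarrow> \<not> (a < n \<longleftrightarrow> b < n)"
proof -
  have "real k - real n + 1/2 < 0 \<longleftrightarrow> k < n" "real k - real n + 1/2 > 0 \<longleftrightarrow> \<not> k < n" for k
    by linarith+
  then show "(real a - real n + 1/2) * (real b - real n + 1/2) > 0 \<longleftrightarrow> (a < n \<longleftrightarrow> b < n)"
    "(real a - real n + 1/2) * (real b - real n + 1/2) < 0 \<longleftrightarrow> \<not> (a < n \<longleftrightarrow> b < n)"
    unfolding zero_less_mult_iff mult_less_0_iff by blast+
qed

theorem theorem4p20:
  fixes n :: nat
    and scale :: "scalar \<Rightarrow> 'v::ab_group_add \<Rightarrow> 'v"
    and J :: "nat \<Rightarrow> 'v"
    and B :: "'v \<Rightarrow> 'v"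
    and \<beta> :: "nat \<Rightarrow> nat \<Rightarrow> scalar"
  assumes "n \<ge> 1"
    and "vector_space scale"
    and "is_basis_family scale (2*n-1) J"
    and "Vector_Spaces.linear scale scale B"
    and "bij B"
    and "\<And>a. a \<le> 2*n-1 \<Longrightarrow>
           B (J a) = scale (qquarter 1) (J (2*n-1-a))
             + (\<Sum>b = a+1..2*n-1. scale (\<beta> a (2*n-1-b)) (J (2*n-1-b)))"
    and "\<And>a b. a \<le> 2*n-1 \<Longrightarrow> b \<le> 2*n-1 \<Longrightarrow>
           mat_entry scale (2*n-1) J B a b - mat_entry scale (2*n-1) J (inv B) a b
             = (qquarter 1 - qquarter (-1)) * (fusion n a * fusion n b - kdelta a b)"
  shows "\<forall>a b. a \<le> 2*n-2 \<longrightarrow> a < b \<longrightarrow> b \<le> 2*n-1 \<longrightarrow>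
     ((real a - real n + 1/2) * (real b - real n + 1/2) > 0 \<longrightarrow>
        \<beta> a (2*n-1-b) = (qquarter 1 - qquarter (-1)) * qquarter (-(int a - int b))) \<and>
     ((real a - real n + 1/2) * (real b - real n + 1/2) < 0 \<longrightarrow>
        \<beta> a (2*n-1-b) = (qquarter (-1) - qquarter 1) * qquarter (-(int a - int b - 1))
          + kdelta a (2*n-1-b) * (qquarter (-1) - qquarter 1))"
proof -
  define N where "N = 2*n-1"
  interpret vector_space scale by fact
  have inj: "inj_on J {0..N}" and indep: "independent (J ` {0..N})"
    using assms(3) by (auto simp: is_basis_family_def N_def)
  note B = assms(6)[folded N_def] and rel = assms(7)[folded N_def]
  have \<beta>: "\<beta> a (N - b) =
      (qquarter 1 - qquarter (-1)) * ((if a < n \<longleftrightarrow> b < n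
        then qquarter (int b - int a) else - qquarter (int b - int a + 1)) - kdelta a (N - b))"
    if "a < b" "b \<le> N" for a b
  proof -
    have "inv B (J a) \<in> span (J ` {N - a..N})"
      by (rule inv_anti_triangular_in_span[OF assms(4,5) B]) (use that qquarter_nonzero in auto)
    \<comment> \<open>Coordinates may be computed in the smaller independent set, where they vanish
      off that set; \<open>J (N - b)\<close> is off it because \<open>N - b < N - a\<close>.\<close>
    then have "representation (J ` {0..N}) (inv B (J a)) =
        representation (J ` {N - a..N}) (inv B (J a))"
      by (intro representation_extend[OF indep]) auto
    moreover have "J (N - b) \<notin> J ` {N - a..N}"
      using that inj_on_image_mem_iff[OF inj, of "N - b" "{N - a..N}"] by auto
    ultimately have "mat_entry scale N J (inv B) a (N - b) = 0"
      unfolding mat_entry_def using representation_ne_zero by metis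
    moreover have "mat_entry scale N J B a (N - b) = \<beta> a (N - b)"
      using that representation_anti_triangular[OF inj indep that, where \<beta> = "\<beta> a"]
      by (simp add: mat_entry_def B)
    ultimately show ?thesis using rel[of a "N - b"] that
      by (simp add: fusion_mult[of a b n, folded N_def])
  qed
  \<comment> \<open>\<open>a = N - b\<close> would put \<open>a\<close> and \<open>b\<close> in
    opposite halves, so the delta term survives only in the second case of the formula.\<close>
  have "kdelta a (N - b) = 0" if "a < n \<longleftrightarrow> b < n" "b \<le> N" for a b
    using that \<open>n \<ge> 1\<close> by (auto simp: kdelta_def N_def)
  then show ?thesis
    unfolding real_half_mult_sign N_def[symmetric]
    by (auto simp: \<beta> algebra_simps)
qed

end
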